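(* Let $r \ge 3$ and let $s, n_1,\ldots, n_r$ be positive integers, $N = n_1+\cdots + n_r$. Then: (i) $\mu_{\rm t}(K_{n_1} \,\square\, \cdots \,\square\, K_{n_r}) \le \frac{6}{r!}\,N^{r-2}$; (ii) $\mu_{\rm t}(K_s^{\square, r}) \leq c_r'\,s^{r-2}$, where $c_r' = 3\prod_{i=3}^r (i-1)^{i-3}$.
   Context: For a connected graph $G$ and $X\subseteq V(G)$, two vertices $x,y$ are $X$-visible if there is a shortest $x,y$-path none of whose internal vertices lies in $X$. $X$ is a total mutual-visibility set if every two vertices of $V(G)$ are $X$-visible. $\mu_{\rm t}(G)$ is the maximum cardinality of a total mutual-visibility set of $G$. $\square$ denotes the Cartesian product of graphs (vertex set the Cartesian product of vertex sets; two tuples adjacent iff they differ in exactly one coordinate and in that coordinate the entries are adjacent in the corresponding factor). $K_n$ is the complete graph on $n$ vertices and $K_s^{\square, r}$ is the Cartesian product of $r$ copies of $K_s$. *)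

theory Defs
  imports "Graph_Theory.Graph_Theory" "HOL-Library.FuncSet"
begin

text \<open>
  As in the AFP entry Graph_Theory, a simple graph is a finite symmetric loop-free digraph
  (locale graph), and an undirected path is a vertex path (vpath) in that digraph.
\<close>

definition shortest_vpath :: "('a, 'b) pre_digraph \<Rightarrow> 'a \<Rightarrow> 'a vwalk \<Rightarrow> 'a \<Rightarrow> bool" where
  "shortest_vpath G x p y \<longleftrightarrow>
     vpath p G \<and> hd p = x \<and> last p = y \<and>
     (\<forall>q. vpath q G \<and> hd q = x \<and> last q = y \<longrightarrow> vwalk_length p \<le> vwalk_length q)"

text \<open>The internal vertices of a path p are the entries of butlast (tl p); a path consisting of
  at most two vertices has none.\<close>

definition visible :: "('a, 'b) pre_digraph \<Rightarrow> 'a set \<Rightarrow> 'a \<Rightarrow> 'a \<Rightarrow> bool" where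
  "visible G X x y \<longleftrightarrow> (\<exists>p. shortest_vpath G x p y \<and> set (butlast (tl p)) \<inter> X = {})"

definition total_mutual_visibility_set :: "('a, 'b) pre_digraph \<Rightarrow> 'a set \<Rightarrow> bool" where
  "total_mutual_visibility_set G X \<longleftrightarrow>
     X \<subseteq> verts G \<and> (\<forall>x\<in>verts G. \<forall>y\<in>verts G. visible G X x y)"

text \<open>Only meaningful for finite connected graphs, see the next lemma.\<close>

definition total_mutual_visibility_number :: "('a, 'b) pre_digraph \<Rightarrow> nat" where
  "total_mutual_visibility_number G = Max {card X | X. total_mutual_visibility_set G X}"

lemma total_mutual_visibility_number_well_defined:
  assumes "graph G" "connected G"
  shows "finite {card X | X. total_mutual_visibility_set G X}"
    and "{card X | X. total_mutual_visibility_set G X} \<noteq> {}"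
proof -
  interpret graph G by fact
  have "{card X | X. total_mutual_visibility_set G X} \<subseteq> card ` Pow (verts G)"
    by (auto simp: total_mutual_visibility_set_def)
  then show "finite {card X | X. total_mutual_visibility_set G X}"
    by (rule finite_subset) simp
  have "visible G {} x y" if "x \<in> verts G" "y \<in> verts G" for x y
  proof -
    have "x \<rightarrow>\<^sup>*\<^bsub>mk_symmetric G\<^esub> y"
      using assms(2) that by (auto simp: connected_def strongly_connected_def)
    then have "x \<rightarrow>\<^sup>*\<^bsub>G\<^esub> y"
      by (simp only: reachable_mk_symmetric_eq[OF sym_arcs])
    then obtain p where "vpath p G \<and> hd p = x \<and> last p = y"
      using reachable_vpath_conv by blast
    from ex_has_least_nat[of "\<lambda>p. vpath p G \<and> hd p = x \<and> last p = y", OF this, of vwalk_length]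
    show ?thesis
      by (auto simp: visible_def shortest_vpath_def)
  qed
  then have "total_mutual_visibility_set G {}"
    by (simp add: total_mutual_visibility_set_def)
  then show "{card X | X. total_mutual_visibility_set G X} \<noteq> {}"
    by blast
qed

text \<open>
  The product of a finite family of graphs; tuples are the extensional functions on the index set.
\<close>

definition cartesian_product_graph ::
    "'i set \<Rightarrow> ('i \<Rightarrow> 'a pair_pre_digraph) \<Rightarrow> ('i \<Rightarrow> 'a) pair_pre_digraph" where
  "cartesian_product_graph I G =
     \<lparr> pverts = (\<Pi>\<^sub>E i\<in>I. pverts (G i)),
       parcs = {(f, g). f \<in> (\<Pi>\<^sub>E i\<in>I. pverts (G i)) \<and> g \<in> (\<Pi>\<^sub>E i\<in>I. pverts (G i)) \<and>
                 (\<exists>i\<in>I. (f i, g i) \<in> parcs (G i) \<and> (\<forall>j\<in>I - {i}. f j = g j))} \<rparr>"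

definition cartesian_power_graph ::
    "'a pair_pre_digraph \<Rightarrow> nat \<Rightarrow> (nat \<Rightarrow> 'a) pair_pre_digraph" where
  "cartesian_power_graph G r = cartesian_product_graph {1..r} (\<lambda>_. G)"

end

theory Submission
  imports Defs
begin

text \<open>
  If X contains f and g at Hamming distance two, then the two vertices completing f and g to a
  4-cycle have exactly f and g as common neighbours, so they are not X-visible. Hence a total
  mutual-visibility set has no two elements at distance exactly two. For three coordinates,
  all elements of X adjacent to f then differ from f in the same coordinate i, and
  f \<open>\<mapsto>\<close> (i, f i) is injective, which gives at most N elements. For more coordinates, fixing the
  i-th entry cuts X into \<open>n\<^sub>i\<close> sets of the same kind with one coordinate less; the first bound
  follows by adding up the resulting estimates over all i, the second by using a single i
  (this already yields the constant 3).
\<close>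

section \<open>Sets of tuples that avoid Hamming distance two\<close>

definition differ :: "'i set \<Rightarrow> ('i \<Rightarrow> 'a) \<Rightarrow> ('i \<Rightarrow> 'a) \<Rightarrow> 'i set" where
  "differ I f g = {i \<in> I. f i \<noteq> g i}"

text \<open>Excluding the distance 0 allows X to be considered over an index set smaller than the one
  its elements live on, so that fixing an entry needs no restriction of functions.\<close>

definition no_distance_two :: "'i set \<Rightarrow> ('i \<Rightarrow> 'a) set \<Rightarrow> bool" where
  "no_distance_two I X \<longleftrightarrow>
     (\<forall>f\<in>X. \<forall>g\<in>X. f \<noteq> g \<longrightarrow> differ I f g \<noteq> {} \<and> card (differ I f g) \<noteq> 2)"

lemma no_distance_two_slice:
  assumes "no_distance_two I X"
  shows "no_distance_two (I - {i}) {f \<in> X. f i = a}"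
proof -
  have "differ (I - {i}) f g = differ I f g" if "f i = a" "g i = a" for f g :: "'a \<Rightarrow> 'b"
    using that by (auto simp: differ_def)
  then show ?thesis
    using assms by (auto simp: no_distance_two_def)
qed

text \<open>For distinct \<open>i\<close> and \<open>j\<close>, going from \<open>g\<close> back to
  \<open>f\<close> changes entry \<open>i\<close> and going on to \<open>h\<close> changes entry
  \<open>j\<close>, so \<open>g\<close> and \<open>h\<close> would be at distance exactly
  two.\<close>

lemma no_distance_two_unique_direction:
  assumes "no_distance_two I X" "f \<in> X" "g \<in> X" "h \<in> X"
    and "differ I f g = {i}" "differ I f h = {j}"
  shows "i = j"
proof (rule ccontr)
  assume "i \<noteq> j"
  have D: "f k \<noteq> g k \<longleftrightarrow> k = i" "f k \<noteq> h k \<longleftrightarrow> k = j" if "k \<in> I" for k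
    using assms(5,6) that by (auto simp: differ_def)
  have "i \<in> I" "j \<in> I"
    using assms(5,6) by (auto simp: differ_def)
  then have "g k \<noteq> h k \<longleftrightarrow> k = i \<or> k = j" if "k \<in> I" for k
    using D[of k] that \<open>i \<noteq> j\<close> by auto
  then have "differ I g h = {i, j}"
    using \<open>i \<in> I\<close> \<open>j \<in> I\<close> by (auto simp: differ_def)
  then have "g \<noteq> h" "card (differ I g h) = 2"
    using \<open>i \<noteq> j\<close> by (auto simp: differ_def)
  then show False
    using assms(1,3,4) by (auto simp: no_distance_two_def)
qed

section \<open>The bound for three coordinates\<close>

lemma card_no_distance_two_3:
  assumes "no_distance_two I X" "card I = 3"
    and "\<And>i. i \<in> I \<Longrightarrow> finite (V i)" "\<And>f i. f \<in> X \<Longrightarrow> i \<in> I \<Longrightarrow> f i \<in> V i"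
  shows "card X \<le> (\<Sum>i\<in>I. card (V i))"
proof -
  have "finite I"
    using assms(2) card.infinite by fastforce
  have "I \<noteq> {}"
    using assms(2) by auto
  have "\<exists>i\<in>I. \<forall>g\<in>X. \<forall>j. differ I f g = {j} \<longrightarrow> j = i" if "f \<in> X" for f
  proof (cases "\<exists>g\<in>X. \<exists>i. differ I f g = {i}")
    case True
    then obtain g i where "g \<in> X" and i: "differ I f g = {i}"
      by blast
    moreover have "i \<in> I"
      using i by (auto simp: differ_def)
    ultimately show ?thesis
      using no_distance_two_unique_direction[OF assms(1) that] by blast
  next
    \<comment> \<open>No element of \<open>X\<close> is at distance one from \<open>f\<close>, so
      any coordinate can serve as its direction.\<close>
    case False
    then show ?thesis
      using \<open>I \<noteq> {}\<close> by blast
  qed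
  then obtain d where dI: "\<And>f. f \<in> X \<Longrightarrow> d f \<in> I"
    and d: "\<And>f g j. f \<in> X \<Longrightarrow> g \<in> X \<Longrightarrow> differ I f g = {j} \<Longrightarrow> j = d f"
    by metis
  \<comment> \<open>Two elements with the same image agree in coordinate \<open>d f\<close>, so they
    differ in at most two of the three coordinates. Distances 0 and 2 are excluded, and distance 1
    would have to be in direction \<open>d f\<close>, where they agree.\<close>
  have "inj_on (\<lambda>f. (d f, f (d f))) X"
  proof (rule inj_onI, rule ccontr)
    fix f g
    assume fg: "f \<in> X" "g \<in> X" "(d f, f (d f)) = (d g, g (d g))" "f \<noteq> g"
    then have "differ I f g \<subseteq> I - {d f}"
      by (auto simp: differ_def)
    then have "card (differ I f g) \<le> 2"
      using card_mono[of "I - {d f}"] \<open>finite I\<close> assms(2) dI[OF fg(1)] by auto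
    moreover have "finite (differ I f g)"
      using \<open>finite I\<close> by (auto simp: differ_def)
    moreover have "differ I f g \<noteq> {} \<and> card (differ I f g) \<noteq> 2"
      using assms(1) fg by (auto simp: no_distance_two_def)
    ultimately have "card (differ I f g) = 1"
      by (metis One_nat_def card_eq_0_iff less_2_cases nat_less_le)
    then obtain j where j: "differ I f g = {j}"
      by (auto simp: card_1_singleton_iff)
    then show False
      using d[OF fg(1,2) j] \<open>differ I f g \<subseteq> I - {d f}\<close> by auto
  qed
  moreover have "(\<lambda>f. (d f, f (d f))) ` X \<subseteq> Sigma I V"
    using dI assms(4) by auto
  moreover have "finite (Sigma I V)"
    using \<open>finite I\<close> assms(3) by auto
  ultimately have "card X \<le> card (Sigma I V)"
    by (rule card_inj_on_le)
  then show ?thesis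
    using \<open>finite I\<close> assms(3) by simp
qed

section \<open>More coordinates, by slicing along an entry\<close>

lemma card_le_slices:
  fixes b :: real
  assumes "finite X" "finite A" "\<And>f. f \<in> X \<Longrightarrow> f i \<in> A"
    and "\<And>a. a \<in> A \<Longrightarrow> card {f \<in> X. f i = a} \<le> b"
  shows "card X \<le> card A * b"
proof -
  have "real (card X) = (\<Sum>f\<in>X. 1)"
    by simp
  also have "\<dots> = (\<Sum>a\<in>A. \<Sum>f\<in>{f \<in> X. f i = a}. 1)"
    by (rule sum.group[symmetric]) (use assms in auto)
  also have "\<dots> \<le> (\<Sum>a\<in>A. b)"
    by (rule sum_mono) (use assms(4) in simp)
  finally show ?thesis
    by simp
qed

text \<open>Slicing along each of the \<open>k + 4\<close> coordinates in turn gives as many upper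
  bounds on \<open>card X\<close>. Their average is better than a single one: it contributes the
  factor \<open>1 / (k + 4)\<close> that turns \<open>fact (k + 3)\<close> into
  \<open>fact (k + 4)\<close>. The induction starts with 6 / 3! = 1.\<close>

lemma card_no_distance_two_le:
  assumes "finite X" "no_distance_two I X" "card I = k + 3"
    and "\<And>i. i \<in> I \<Longrightarrow> finite (V i)" "\<And>f i. f \<in> X \<Longrightarrow> i \<in> I \<Longrightarrow> f i \<in> V i"
  shows "card X \<le> 6 / fact (k + 3) * real (\<Sum>i\<in>I. card (V i)) ^ (k + 1)"
  using assms
proof (induction k arbitrary: I X)
  case 0
  then have "card X \<le> (\<Sum>i\<in>I. card (V i))"
    by (intro card_no_distance_two_3) auto
  then have "real (card X) \<le> real (\<Sum>i\<in>I. card (V i))"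
    by (simp only: of_nat_le_iff)
  then show ?case
    by (simp add: fact_numeral)
next
  case (Suc k)
  define N where "N = (\<Sum>i\<in>I. card (V i))"
  define b where "b = 6 / fact (k + 3) * real N ^ (k + 1)"
  have "finite I"
    using Suc.prems(3) card.infinite by fastforce
  have le: "real (card X) \<le> card (V i) * b" if "i \<in> I" for i
  proof (rule card_le_slices)
    fix a
    have "card {f \<in> X. f i = a}
        \<le> 6 / fact (k + 3) * real (\<Sum>j\<in>I - {i}. card (V j)) ^ (k + 1)"
      using Suc.prems that \<open>finite I\<close> by (intro Suc.IH no_distance_two_slice) auto
    \<comment> \<open>Enlarging the sum to all of \<open>I\<close> makes the bound \<open>b\<close>
      independent of \<open>i\<close>, so that the bounds can be added up.\<close>
    also have "\<dots> \<le> b"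
    proof -
      have "(\<Sum>j\<in>I - {i}. card (V j)) \<le> N"
        unfolding N_def using \<open>finite I\<close> by (intro sum_mono2) auto
      then have "real (\<Sum>j\<in>I - {i}. card (V j)) \<le> real N"
        by (simp only: of_nat_le_iff)
      then show ?thesis
        unfolding b_def by (intro mult_left_mono power_mono of_nat_0_le_iff) simp_all
    qed
    finally show "card {f \<in> X. f i = a} \<le> b" .
  qed (use Suc.prems that in auto)
  have "real (k + 4) * card X = (\<Sum>i\<in>I. real (card X))"
    using Suc.prems(3) by simp
  also have "\<dots> \<le> (\<Sum>i\<in>I. card (V i) * b)"
    by (rule sum_mono) (rule le)
  also have "\<dots> = real N * b"
    by (simp add: N_def sum_distrib_right)
  finally have "card X \<le> real N * b / real (k + 4)"
    by (simp add: field_simps)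
  also have "\<dots> = 6 / (real (k + 4) * fact (k + 3)) * real N ^ (Suc k + 1)"
    by (simp add: b_def mult_ac)
  also have "real (k + 4) * fact (k + 3) = fact (Suc k + 3)"
    using fact_Suc[of "k + 3", where ?'a = real] by (simp add: add.commute del: fact_Suc)
  finally show ?case
    by (simp only: N_def)
qed

text \<open>With equal sizes the bound for three coordinates is \<open>3 * s\<close>, and every
  further coordinate costs a factor \<open>s\<close>, the number of slices.\<close>

lemma card_no_distance_two_uniform:
  assumes "finite X" "no_distance_two I X" "card I = k + 3"
    and "\<And>i. i \<in> I \<Longrightarrow> finite (V i)" "\<And>f i. f \<in> X \<Longrightarrow> i \<in> I \<Longrightarrow> f i \<in> V i"
    and "\<And>i. i \<in> I \<Longrightarrow> card (V i) = s"
  shows "card X \<le> 3 * s ^ (k + 1)"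
  using assms
proof (induction k arbitrary: I X)
  case 0
  then have "card X \<le> (\<Sum>i\<in>I. card (V i))"
    by (intro card_no_distance_two_3) auto
  then show ?case
    using 0 by simp
next
  case (Suc k)
  have "finite I"
    using Suc.prems(3) card.infinite by fastforce
  obtain i where "i \<in> I"
    using Suc.prems(3) by fastforce
  have "card X \<le> card (V i) * real (3 * s ^ (k + 1))"
  proof (rule card_le_slices)
    fix a
    have "card {f \<in> X. f i = a} \<le> 3 * s ^ (k + 1)"
      using Suc.prems \<open>i \<in> I\<close> \<open>finite I\<close> by (intro Suc.IH[where I = "I - {i}"] no_distance_two_slice) auto
    then show "real (card {f \<in> X. f i = a}) \<le> real (3 * s ^ (k + 1))"
      by (simp only: of_nat_le_iff)
  qed (use Suc.prems \<open>i \<in> I\<close> in auto)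
  then have "real (card X) \<le> real (3 * s ^ (Suc k + 1))"
    using Suc.prems(6)[OF \<open>i \<in> I\<close>] by (simp add: mult_ac)
  then show ?case
    by (simp only: of_nat_le_iff)
qed

section \<open>Cartesian products of complete graphs\<close>

text \<open>Covers both products of the theorem. The order of a factor is read off its vertex set,
  and \<open>nonempty_factor\<close> provides the vertex that \<open>connected\<close>
  demands.\<close>

locale hamming_graph =
  fixes I :: "'i set" and K :: "'i \<Rightarrow> 'a pair_pre_digraph"
  assumes finite_index: "finite I"
    and nonempty_factor: "\<And>i. i \<in> I \<Longrightarrow> pverts (K i) \<noteq> {}"
    and complete_factor: "\<And>i. i \<in> I \<Longrightarrow> complete_digraph (card (pverts (K i))) (with_proj (K i))"
begin

abbreviation P where "P \<equiv> cartesian_product_graph I K"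

lemma finite_factor: "i \<in> I \<Longrightarrow> finite (pverts (K i))"
  using complete_factor by (auto simp: complete_digraph_pair_def)

lemma parcs_factor:
  assumes "i \<in> I"
  shows "(u, v) \<in> parcs (K i) \<longleftrightarrow> u \<in> pverts (K i) \<and> v \<in> pverts (K i) \<and> u \<noteq> v"
proof -
  have "parcs (K i) = {(u, v). (u, v) \<in> pverts (K i) \<times> pverts (K i) \<and> u \<noteq> v}"
    using complete_factor[OF assms] by (simp only: complete_digraph_pair_def)
  then show ?thesis
    by simp
qed

lemma pverts_P: "pverts P = (\<Pi>\<^sub>E i\<in>I. pverts (K i))"
  by (simp add: cartesian_product_graph_def)

text \<open>In a complete factor any two distinct entries are adjacent, so adjacency in the product
  is Hamming distance one. Later arguments use arcs only in this form.\<close>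

lemma parcs_P:
  "(f, g) \<in> parcs P \<longleftrightarrow> f \<in> pverts P \<and> g \<in> pverts P \<and> (\<exists>i. differ I f g = {i})"
proof -
  have "(f i, g i) \<in> parcs (K i) \<and> (\<forall>j\<in>I - {i}. f j = g j) \<longleftrightarrow> differ I f g = {i}"
    if "f \<in> pverts P" "g \<in> pverts P" "i \<in> I" for i
  proof -
    have "f i \<in> pverts (K i)" "g i \<in> pverts (K i)"
      using that by (auto simp: pverts_P)
    then show ?thesis
      using \<open>i \<in> I\<close> by (auto simp: parcs_factor differ_def)
  qed
  moreover have "i \<in> I" if "differ I f g = {i}" for i
    using that by (auto simp: differ_def)
  ultimately show ?thesis
    by (auto simp: cartesian_product_graph_def)
qed

lemma pverts_P_upd:
  assumes "f \<in> pverts P" "g \<in> pverts P" "i \<in> I"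
  shows "f(i := g i) \<in> pverts P"
  using assms by (auto simp: pverts_P PiE_iff extensional_def)

lemma pair_graph_P: "pair_graph P"
proof
  show "finite (pverts P)"
    using finite_index finite_factor by (auto simp: pverts_P intro: finite_PiE)
  moreover have "parcs P \<subseteq> pverts P \<times> pverts P"
    by (auto simp: parcs_P)
  ultimately show "finite (parcs P)"
    by (meson finite_SigmaI finite_subset)
  have "differ I f g = differ I g f" for f g :: "'i \<Rightarrow> 'a"
    by (auto simp: differ_def)
  then show "symmetric (with_proj P)"
    by (auto simp: symmetric_def parcs_P intro!: symI)
qed (auto simp: parcs_P differ_def)

sublocale pair_graph P
  by (rule pair_graph_P)

text \<open>Replacing one wrong entry of \<open>f\<close> by that of \<open>g\<close> is a step
  along an arc and lowers the distance to \<open>g\<close> by one.\<close>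

lemma reachable_P:
  assumes "f \<in> pverts P" "g \<in> pverts P"
  shows "f \<rightarrow>\<^sup>*\<^bsub>with_proj P\<^esub> g"
  using assms(1)
proof (induction "card (differ I f g)" arbitrary: f)
  case 0
  then have "differ I f g = {}"
    using finite_index by (simp add: differ_def)
  then have "f = g"
    using 0 assms(2) by (intro PiE_ext[of _ I]) (auto simp: pverts_P differ_def)
  then show ?case
    using 0 by simp
next
  case (Suc k)
  then obtain i where i: "i \<in> differ I f g"
    by (metis card.empty ex_in_conv nat.distinct(1))
  define h where "h = f(i := g i)"
  have "i \<in> I"
    using i by (simp add: differ_def)
  have h: "h \<in> pverts P"
    unfolding h_def by (rule pverts_P_upd) (use Suc assms(2) \<open>i \<in> I\<close> in auto)
  have "differ I h g = differ I f g - {i}"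
    by (auto simp: differ_def h_def)
  then have "k = card (differ I h g)"
    using Suc.hyps(2) i by simp
  then have "h \<rightarrow>\<^sup>*\<^bsub>with_proj P\<^esub> g"
    using Suc.hyps(1) h by blast
  moreover have "differ I f h = {i}"
    using i by (auto simp: differ_def h_def)
  then have "(f, h) \<in> parcs P"
    using Suc.prems h by (auto simp: parcs_P)
  ultimately show ?case
    by (meson adj_reachable_trans)
qed

lemma connected_P: "connected (with_proj P)"
proof -
  have "pverts P \<noteq> {}"
    using nonempty_factor by (auto simp: pverts_P PiE_eq_empty_iff)
  then show ?thesis
    using reachable_P reachable_mk_symmetric_eq[OF pair_sym_arcs]
    by (auto simp: connected_def strongly_connected_def)
qed

section \<open>From visibility to Hamming distance\<close>

lemma total_mutual_visibility_set_no_distance_two: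
  assumes "total_mutual_visibility_set (with_proj P) X"
  shows "no_distance_two I X"
  unfolding no_distance_two_def
proof (intro ballI impI conjI)
  fix f g
  assume fg: "f \<in> X" "g \<in> X" "f \<noteq> g"
  have fgP: "f \<in> pverts P" "g \<in> pverts P"
    using assms fg by (auto simp: total_mutual_visibility_set_def)
  show "differ I f g \<noteq> {}"
  proof
    assume "differ I f g = {}"
    then have "f = g"
      using fgP by (intro PiE_ext[of _ I]) (auto simp: pverts_P differ_def)
    then show False
      using fg by simp
  qed
  show "card (differ I f g) \<noteq> 2"
  proof
    assume "card (differ I f g) = 2"
    then obtain i j where ij: "differ I f g = {i, j}" "i \<noteq> j"
      by (auto simp: card_2_iff)
    then have I: "i \<in> I" "j \<in> I" "f i \<noteq> g i" "f j \<noteq> g j"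
      by (auto simp: differ_def)
    have eq: "f k = g k" if "k \<in> I" "k \<noteq> i" "k \<noteq> j" for k
      using ij that by (auto simp: differ_def)
    \<comment> \<open>\<open>x\<close> and \<open>y\<close> are the other two corners of the 4-cycle
      through \<open>f\<close> and \<open>g\<close>: \<open>x\<close> has the entry of
      \<open>g\<close> at \<open>i\<close> and of \<open>f\<close> at \<open>j\<close>, and
      \<open>y\<close> has them the other way round.\<close>
    define x where "x = f(i := g i)"
    define y where "y = g(i := f i)"
    have xy: "x \<in> pverts P" "y \<in> pverts P"
      unfolding x_def y_def using fgP I by (auto intro: pverts_P_upd)
    have "differ I x f = {i}" "differ I f y = {j}"
      using I eq ij by (auto simp: differ_def x_def y_def)
    then have "(x, f) \<in> parcs P" "(f, y) \<in> parcs P"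
      using xy fgP by (auto simp: parcs_P)
    moreover have "x \<noteq> y" "x \<noteq> f" "f \<noteq> y"
      using I \<open>i \<noteq> j\<close> by (auto simp: x_def y_def fun_eq_iff)
    ultimately have "vpath [x, f, y] (with_proj P)"
      using xy fgP by (auto simp: vpath_def vwalk_def)
    moreover have "visible (with_proj P) X x y"
      using assms xy by (simp add: total_mutual_visibility_set_def)
    then obtain p where p: "shortest_vpath (with_proj P) x p y" "set (butlast (tl p)) \<inter> X = {}"
      unfolding visible_def by blast
    \<comment> \<open>The path through \<open>f\<close> only serves to bound the length.
      \<open>vwalk_length\<close> counts arcs, so \<open>p\<close> has at most three
      vertices.\<close>
    ultimately have "vwalk_length p \<le> vwalk_length [x, f, y]"
      unfolding shortest_vpath_def by (metis last.simps list.sel(1) list.distinct(1))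
    then have "length p \<le> 3"
      by simp
    have diffxy: "differ I x y = {i, j}"
      using I eq ij by (auto simp: differ_def x_def y_def)
    have walk: "vwalk p (with_proj P)" "hd p = x" "last p = y"
      using p(1) by (auto simp: shortest_vpath_def vpath_def)
    consider "p = []" | "p = [x]" | "p = [x, y]" | m where "p = [x, m, y]"
    proof -
      assume *: "p = [] \<Longrightarrow> thesis" "p = [x] \<Longrightarrow> thesis" "p = [x, y] \<Longrightarrow> thesis"
        "\<And>m. p = [x, m, y] \<Longrightarrow> thesis"
      \<comment> \<open>\<open>remdups_adj.cases\<close> is borrowed for its split into lists with
        no, one, or at least two entries; \<open>tl (tl p)\<close> then separates two from
        three.\<close>
      show thesis
        using * \<open>length p \<le> 3\<close> walk(2,3)
        by (cases p rule: remdups_adj.cases; cases "tl (tl p)") (auto split: if_splits)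
    qed
    then show False
    proof cases
      case 1
      then show False
        using walk(1) by (simp add: vwalk_def)
    next
      case 2
      then show False
        using walk \<open>x \<noteq> y\<close> by simp
    next
      case 3
      then have "(x, y) \<in> parcs P"
        using walk by (simp add: vwalk_def)
      then show False
        using diffxy \<open>i \<noteq> j\<close> by (auto simp: parcs_P)
    next
      case 4
      then have "(x, m) \<in> parcs P" "(m, y) \<in> parcs P"
        using walk by (auto simp: vwalk_def)
      then obtain k l where kl: "differ I x m = {k}" "differ I m y = {l}" and m: "m \<in> pverts P"
        by (auto simp: parcs_P)
      have xm: "x u = m u" if "u \<in> I" "u \<noteq> k" for u
        using kl that by (auto simp: differ_def)
      have my: "m u = y u" if "u \<in> I" "u \<noteq> l" for u
        using kl that by (auto simp: differ_def)
      \<comment> \<open>The walk changes only entry \<open>k\<close> and then entry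
        \<open>l\<close>, yet its ends differ in both \<open>i\<close> and \<open>j\<close>.\<close>
      have "{i, j} \<subseteq> {k, l}"
      proof
        fix u
        assume "u \<in> {i, j}"
        then have "u \<in> I" "x u \<noteq> y u"
          using diffxy by (auto simp: differ_def)
        then show "u \<in> {k, l}"
          using xm my by fastforce
      qed
      then consider "k = i" "l = j" | "k = j" "l = i"
        using \<open>i \<noteq> j\<close> by auto
      \<comment> \<open>Changing entry \<open>i\<close> of \<open>x\<close> first leads to
        \<open>f\<close>, changing entry \<open>j\<close> first leads to \<open>g\<close>. Both lie
        in \<open>X\<close>, but \<open>m\<close> is internal to \<open>p\<close>.\<close>
      then have "m = f \<or> m = g"
      proof cases
        case 1
        have "m u = f u" if "u \<in> I" for u
          using xm[OF that] my[OF that] 1 \<open>i \<noteq> j\<close> by (cases "u = i") (auto simp: x_def y_def)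
        then show ?thesis
          using m fgP PiE_ext[of m I _ f] by (auto simp: pverts_P)
      next
        case 2
        have "m u = g u" if "u \<in> I" for u
          using xm[OF that] my[OF that] 2 \<open>i \<noteq> j\<close> by (cases "u = i") (auto simp: x_def y_def)
        then show ?thesis
          using m fgP PiE_ext[of m I _ g] by (auto simp: pverts_P)
      qed
      then show False
        using 4 p(2) fg by auto
    qed
  qed
qed

text \<open>Since \<open>P\<close> is connected, the maximum is taken over a finite nonempty set. A
  bound for all sets without distance two is thus a bound for the number.\<close>

lemma total_mutual_visibility_number_attained:
  obtains X where "finite X" "no_distance_two I X" "X \<subseteq> pverts P"
    and "total_mutual_visibility_number (with_proj P) = card X"
proof -
  have "graph (with_proj P)"
    by unfold_locales
  then have "total_mutual_visibility_number (with_proj P)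
      \<in> {card X | X. total_mutual_visibility_set (with_proj P) X}"
    unfolding total_mutual_visibility_number_def
    using connected_P by (intro Max_in total_mutual_visibility_number_well_defined)
  then obtain X where X: "total_mutual_visibility_set (with_proj P) X"
    "total_mutual_visibility_number (with_proj P) = card X"
    by auto
  then have "X \<subseteq> pverts P"
    by (simp add: total_mutual_visibility_set_def)
  then show thesis
    using that X total_mutual_visibility_set_no_distance_two pair_finite_verts finite_subset
    by metis
qed

end

section \<open>The two bounds for products of complete graphs\<close>

theorem theorem1p2:
  fixes r s N :: nat and n :: "nat \<Rightarrow> nat"
    and K :: "nat \<Rightarrow> 'a pair_pre_digraph" and H :: "'b pair_pre_digraph"
  assumes "r \<ge> 3"
    and "s \<ge> 1"
    and "\<And>i. i \<in> {1..r} \<Longrightarrow> n i \<ge> 1"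
    and "N = (\<Sum>i=1..r. n i)"
    and "\<And>i. i \<in> {1..r} \<Longrightarrow> complete_digraph (n i) (with_proj (K i))"
    and "complete_digraph s (with_proj H)"
  shows "real (total_mutual_visibility_number (with_proj (cartesian_product_graph {1..r} K)))
           \<le> 6 / fact r * real N ^ (r - 2)
       \<and> total_mutual_visibility_number (with_proj (cartesian_power_graph H r))
           \<le> (3 * (\<Prod>i=3..r. (i - 1) ^ (i - 3))) * s ^ (r - 2)"
proof
  \<comment> \<open>\<open>k\<close> counts the coordinates beyond three, so the exponent
    \<open>r - 2\<close> is \<open>k + 1\<close>.\<close>
  obtain k where r: "r = k + 3"
    using assms(1) by (metis add.commute le_Suc_ex)
  have card_K: "card (pverts (K i)) = n i" if "i \<in> {1..r}" for i
    using assms(5)[OF that] by (simp add: complete_digraph_pair_def)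
  interpret K: hamming_graph "{1..r}" K
  proof
    fix i
    assume i: "i \<in> {1..r}"
    show "pverts (K i) \<noteq> {}"
      using card_K[OF i] assms(3)[OF i] by auto
    show "complete_digraph (card (pverts (K i))) (with_proj (K i))"
      using assms(5)[OF i] card_K[OF i] by simp
  qed simp
  obtain X where X: "finite X" "no_distance_two {1..r} X" "X \<subseteq> pverts K.P"
    "total_mutual_visibility_number (with_proj K.P) = card X"
    by (rule K.total_mutual_visibility_number_attained)
  have entries_X: "f i \<in> pverts (K i)" if "f \<in> X" "i \<in> {1..r}" for f i
    using that by (intro PiE_mem[OF subsetD[OF X(3)[unfolded K.pverts_P]]])
  have "card X \<le> 6 / fact (k + 3) * real (\<Sum>i\<in>{1..r}. card (pverts (K i))) ^ (k + 1)"
    by (rule card_no_distance_two_le) (use X(1,2) entries_X r K.finite_factor in auto)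
  also have "(\<Sum>i\<in>{1..r}. card (pverts (K i))) = N"
    using card_K assms(4) by simp
  finally show "real (total_mutual_visibility_number (with_proj (cartesian_product_graph {1..r} K)))
      \<le> 6 / fact r * real N ^ (r - 2)"
    using X(4) r by simp
  have card_H: "card (pverts H) = s"
    using assms(6) by (simp add: complete_digraph_pair_def)
  interpret H: hamming_graph "{1..r}" "\<lambda>_. H"
    by unfold_locales (use card_H assms(2,6) in auto)
  obtain Y where Y: "finite Y" "no_distance_two {1..r} Y" "Y \<subseteq> pverts H.P"
    "total_mutual_visibility_number (with_proj H.P) = card Y"
    by (rule H.total_mutual_visibility_number_attained)
  have entries_Y: "f i \<in> pverts (H)" if "f \<in> Y" "i \<in> {1..r}" for f i
    using that by (intro PiE_mem[OF subsetD[OF Y(3)[unfolded H.pverts_P]]])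
  have "card Y \<le> 3 * s ^ (k + 1)"
    by (rule card_no_distance_two_uniform[where V = "\<lambda>_. pverts H"])
      (use Y(1,2) entries_Y r H.finite_factor card_H in auto)
  \<comment> \<open>The 1 is a placeholder for the product, all of whose factors are at least
    one.\<close>
  also have "\<dots> = 3 * 1 * s ^ (r - 2)"
    using r by simp
  also have "\<dots> \<le> 3 * (\<Prod>i=3..r. (i - 1) ^ (i - 3)) * s ^ (r - 2)"
    by (intro mult_le_mono le_refl prod_ge_1 one_le_power) auto
  finally show "total_mutual_visibility_number (with_proj (cartesian_power_graph H r))
      \<le> (3 * (\<Prod>i=3..r. (i - 1) ^ (i - 3))) * s ^ (r - 2)"
    using Y(4) by (simp add: cartesian_power_graph_def)
qed

end
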